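(* Let $f=a_0+a_1x+\cdots +a_nx^n\in \mathbb Z[x]$ be a polynomial of degree $n$, and put $H_f=\max_{0\leq i\leq n-1}|a_i|/|a_n|$. Suppose there exist positive integers $m$ and $d$ such that $m\geq H_f+d+1$, $d$ is a unitary divisor of $|f(m)|$ (i.e. $d$ divides $|f(m)|$ and $\gcd(d,|f(m)|/d)=1$), and $|f(m)/d|>1$. Let $\nu_m$ denote the number of prime factors of $|f(m)/d|$ counted with multiplicities. Then the polynomial $f$ is a product of at most $\nu_m$ irreducible factors in $\mathbb Z[x]$. In particular, if $\nu_m=1$ for such an $m$, then $f$ is irreducible in $\mathbb Z[x]$.
   Context: For a positive divisor $d$ of a natural number $a$, $d$ is called a unitary divisor of $a$ (written $d\| a$) if $\gcd(d,a/d)=1$.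
   Formalization: False as stated if prime constants count as irreducible factors (f=2x, m=3, d=2); the formal claim is for f when the gcd of its coefficients is coprime to d, and in general for the primitive part of f; n≥1 is assumed so that H_f is defined. *)

theory Defs
  imports Complex_Main "HOL-Computational_Algebra.Computational_Algebra"
begin

(* Meaningful only for degree f > 0: otherwise the maximum is over the empty set. *)
definition coeff_height :: "int poly \<Rightarrow> real" where
  "coeff_height f =
     Max ((\<lambda>i. real_of_int \<bar>coeff f i\<bar> / real_of_int \<bar>lead_coeff f\<bar>) ` {..<degree f})"

definition unitary_divisor :: "nat \<Rightarrow> nat \<Rightarrow> bool" where
  "unitary_divisor d a \<longleftrightarrow> d > 0 \<and> d dvd a \<and> gcd d (a div d) = 1"

definition num_prime_factors :: "nat \<Rightarrow> nat" where
  "num_prime_factors a = size (prime_factorization a)"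

(* No separate unit factor is allowed; a unit can be absorbed into one of the factors. *)
definition product_of_at_most_irreducibles :: "nat \<Rightarrow> 'a :: comm_semiring_1 \<Rightarrow> bool" where
  "product_of_at_most_irreducibles k f \<longleftrightarrow>
     (\<exists>gs. size gs \<le> k \<and> (\<forall>g \<in># gs. irreducible g) \<and> f = prod_mset gs)"

(* The predicate "irreducible" on int poly is irreducibility in the ring Z[x], where prime
   constants are irreducible. Primes dividing both the content of f and d are not seen by
   the cofactor |f(m)| / d: f = 2x, m = 3, d = 2 gives |f(m)| / d = 3, although f = 2 * x.
   So irreducibility in Z[x] is claimed for f itself only if content f is coprime to d
   (in particular for primitive f and for d = 1), and for primitive_part f in general, i.e.
   for f up to the constant factor content f, f = smult (content f) (primitive_part f). *)
lemma unitary_divisor_content_example: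
  fixes f :: "int poly"
  assumes "f = [:0, 2:]"
  shows "real 3 \<ge> coeff_height f + real 2 + 1"
    and "unitary_divisor 2 (nat \<bar>poly f (int 3)\<bar>)"
    and "num_prime_factors (nat \<bar>poly f (int 3)\<bar> div 2) = 1"
    and "\<not> irreducible f"
proof -
  have "{..<degree f} = {0}" using assms by auto
  then show "real 3 \<ge> coeff_height f + real 2 + 1"
    using assms by (simp add: coeff_height_def)
  show "unitary_divisor 2 (nat \<bar>poly f (int 3)\<bar>)"
    using assms by (simp add: unitary_divisor_def)
  have "prime (3 :: nat)" by simp
  then show "num_prime_factors (nat \<bar>poly f (int 3)\<bar> div 2) = 1"
    using assms by (simp add: num_prime_factors_def prime_factorization_prime)
  have "f = [:2:] * [:0, 1:]" using assms by simp
  moreover have "\<not> [:2 :: int:] dvd 1" "\<not> [:0, 1 :: int:] dvd 1"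
    by (auto simp: is_unit_poly_iff)
  ultimately show "\<not> irreducible f" unfolding irreducible_def by blast
qed

end

theory Submission imports Defs begin

text \<open>
  By Cauchy's bound every complex root \<open>z\<close> of \<open>f\<close> satisfies \<open>|z| < 1 + H\<^sub>f\<close>, hence \<open>|m - z| > d\<close>.
  A nonconstant divisor \<open>g\<close> of \<open>f\<close> therefore has \<open>|g(m)| > d\<close>. Put \<open>q = |f(m)|/d\<close>, which is coprime
  to \<open>d\<close>. As \<open>g(m)\<close> divides \<open>d q\<close> and is too large to divide \<open>d\<close>, it shares a prime with \<open>q\<close>; the
  primes chosen for the factors in a factorization of \<open>f\<close> multiply to a divisor of \<open>q\<close>, so there
  are at most \<open>\<nu>\<^sub>m\<close> of them.
\<close>

text \<open>At a root the leading term cancels the lower ones, but for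
  \<open>norm z \<ge> 1 + H\<close> a geometric sum bounds the lower terms by
  \<open>norm (lead_coeff p) * (norm z ^ n - 1)\<close>, with \<open>n\<close> the degree, which is
  too small.\<close>

lemma Cauchy_root_bound:
  fixes p :: "'a :: real_normed_field poly"
  assumes coeffs: "\<And>i. i < degree p \<Longrightarrow> norm (coeff p i) \<le> H * norm (lead_coeff p)"
    and "H \<ge> 0" and "p \<noteq> 0" and root: "poly p z = 0"
  shows "norm z < 1 + H"
proof (rule ccontr)
  assume "\<not> norm z < 1 + H"
  then have H: "H \<le> norm z - 1" by simp
  let ?n = "degree p" and ?a = "norm (lead_coeff p)"
  have "poly p z = (\<Sum>i<?n. coeff p i * z ^ i) + lead_coeff p * z ^ ?n"
    by (simp add: poly_altdef flip: lessThan_Suc_atMost)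
  with root have "lead_coeff p * z ^ ?n = - (\<Sum>i<?n. coeff p i * z ^ i)"
    by (simp add: eq_neg_iff_add_eq_0 add.commute)
  then have "?a * norm z ^ ?n = norm (\<Sum>i<?n. coeff p i * z ^ i)"
    using norm_mult norm_power norm_minus_cancel by (metis (no_types, lifting))
  also have "\<dots> \<le> (\<Sum>i<?n. H * ?a * norm z ^ i)"
    by (rule sum_norm_le) (auto simp: norm_mult norm_power intro!: mult_right_mono coeffs)
  also have "\<dots> = ?a * (H * (\<Sum>i<?n. norm z ^ i))"
    by (simp add: sum_distrib_left mult_ac)
  \<comment> \<open>Replacing \<open>H\<close> by \<open>norm z - 1\<close> makes the geometric sum
    telescope without a division by \<open>norm z - 1\<close>, which vanishes if
    \<open>H = 0\<close> and \<open>norm z = 1\<close>.\<close>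
  also have "\<dots> \<le> ?a * ((norm z - 1) * (\<Sum>i<?n. norm z ^ i))"
    using H by (intro mult_left_mono mult_right_mono sum_nonneg) auto
  also have "\<dots> = ?a * (norm z ^ ?n - 1)"
    by (simp flip: power_diff_1_eq)
  also have "\<dots> < ?a * norm z ^ ?n"
    using \<open>p \<noteq> 0\<close> by simp
  finally show False by simp
qed

text \<open>Up to the leading coefficient, the value at \<open>x\<close> is the product of the
  differences \<open>x - z\<close> over the roots. One of them contributes more than
  \<open>c\<close>, and the others do not shrink the product because
  \<open>c \<ge> 1\<close>.\<close>

lemma norm_poly_gt_if_far_from_roots:
  fixes p :: "complex poly"
  assumes "degree p > 0" and "c \<ge> 1"
    and far: "\<And>z. poly p z = 0 \<Longrightarrow> norm (x - z) > c"
  shows "norm (poly p x) > c * norm (lead_coeff p)"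
proof -
  obtain A where A: "size A = degree p" "p = smult (lead_coeff p) (\<Prod>z\<in>#A. [:-z, 1:])"
    using alg_closed_imp_factorization[of p] assms(1) by (metis degree_0 less_irrefl)
  have val: "poly p y = lead_coeff p * (\<Prod>z\<in>#A. y - z)" for y
    by (subst A(2)) (simp add: poly_prod_mset image_mset.compositionality o_def)
  have root: "norm (x - z) > c" if "z \<in># A" for z
    using that by (intro far) (auto simp: val prod_mset_zero_iff)
  \<comment> \<open>Inducting over submultisets of \<open>A\<close> keeps every element a
    root.\<close>
  have ge: "norm (\<Prod>z\<in>#B. x - z) \<ge> 1" if "B \<subseteq># A" for B
    using that
  proof (induction B)
    case (add z B)
    then have "z \<in># A" "B \<subseteq># A"
      by (auto dest: mset_subset_eq_insertD subset_mset.less_imp_le)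
    then have "1 * 1 \<le> norm (x - z) * norm (\<Prod>z\<in>#B. x - z)"
      using add.IH root[of z] \<open>c \<ge> 1\<close> by (intro mult_mono) auto
    then show ?case by (simp add: norm_mult)
  qed simp
  from A(1) assms(1) obtain z B where zB: "A = add_mset z B"
    by (metis multiset_nonemptyE multi_member_split size_empty less_irrefl)
  have "c < norm (x - z)" using root zB by simp
  also have "\<dots> \<le> norm (x - z) * norm (\<Prod>z\<in>#B. x - z)"
    using ge[of B] zB by (intro mult_le_cancel_left1[THEN iffD2]) auto
  finally have "c < norm (\<Prod>z\<in>#A. x - z)" by (simp add: zB norm_mult)
  moreover have "norm (lead_coeff p) > 0" using assms(1) by auto
  ultimately show ?thesis by (simp add: val norm_mult mult.commute)
qed

lemma poly_of_int_poly:
  "poly (map_poly of_int p :: 'a :: {comm_ring_1, ring_char_0} poly) (of_int x) = of_int (poly p x)"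
  by (induction p) (auto simp: map_poly_pCons)

lemma map_poly_of_int_mult:
  "(map_poly of_int (p * q) :: 'a :: {comm_ring_1, ring_char_0} poly) =
     map_poly of_int p * map_poly of_int q"
  by (intro poly_eqI) (simp add: coeff_map_poly coeff_mult)

lemma coeff_height_ge:
  assumes "i < degree f"
  shows "real_of_int \<bar>coeff f i\<bar> \<le> coeff_height f * real_of_int \<bar>lead_coeff f\<bar>"
proof -
  have "real_of_int \<bar>coeff f i\<bar> / real_of_int \<bar>lead_coeff f\<bar> \<le> coeff_height f"
    unfolding coeff_height_def using assms by (intro Max_ge) auto
  moreover have "lead_coeff f \<noteq> 0" using assms by auto
  ultimately show ?thesis by (simp add: divide_le_eq)
qed

text \<open>The roots of \<open>g\<close> are roots of \<open>f\<close>, so the height of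
  \<open>f\<close> bounds them, however large the coefficients of \<open>g\<close> are; thus
  \<open>m\<close> is at distance more than \<open>d\<close> from each.\<close>

lemma nonconst_dvd_value_gt:
  fixes f g :: "int poly" and m d :: nat
  assumes "g dvd f" and "degree g > 0" and "f \<noteq> 0" and "d > 0"
    and m: "real m \<ge> coeff_height f + real d + 1"
  shows "\<bar>poly g (int m)\<bar> > int d"
proof -
  let ?h = "\<lambda>p. map_poly of_int p :: complex poly"
  have deg: "degree (?h p) = degree p" for p by (simp add: degree_map_poly)
  obtain k where k: "f = g * k" using \<open>g dvd f\<close> by (auto elim: dvdE)
  then have "degree f > 0" using assms(2,3) by (auto simp: degree_mult_eq)
  \<comment> \<open>Index 0 lies in the range of the maximum because
    \<open>degree f > 0\<close>.\<close>
  have "0 \<le> real_of_int \<bar>coeff f 0\<bar> / real_of_int \<bar>lead_coeff f\<bar>" by simp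
  also have "\<dots> \<le> coeff_height f"
    unfolding coeff_height_def using \<open>degree f > 0\<close> by (intro Max_ge) auto
  finally have H0: "coeff_height f \<ge> 0" .
  have far: "norm (of_nat m - z) > real d" if "poly (?h g) z = 0" for z
  proof -
    have "norm z < 1 + coeff_height f"
    proof (rule Cauchy_root_bound)
      show "norm (coeff (?h f) i) \<le> coeff_height f * norm (lead_coeff (?h f))"
        if "i < degree (?h f)" for i
        using coeff_height_ge[of i f] that by (simp add: deg coeff_map_poly)
      show "?h f \<noteq> 0" using \<open>degree f > 0\<close> deg[of f] by auto
      show "poly (?h f) z = 0" using that by (simp add: k map_poly_of_int_mult)
    qed (fact H0)
    with m have "real d < norm (of_nat m :: complex) - norm z" by simp
    also have "\<dots> \<le> norm (of_nat m - z)" by (rule norm_triangle_ineq2)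
    finally show ?thesis .
  qed
  have "norm (lead_coeff (?h g)) = real_of_int \<bar>lead_coeff g\<bar>"
    by (simp add: deg coeff_map_poly)
  moreover have "lead_coeff g \<noteq> 0" using assms(2) by auto
  then have "1 \<le> \<bar>lead_coeff g\<bar>" by linarith
  then have "1 \<le> real_of_int \<bar>lead_coeff g\<bar>" by linarith
  ultimately have "real d * 1 \<le> real d * norm (lead_coeff (?h g))"
    by (intro mult_left_mono) auto
  also have "\<dots> < norm (poly (?h g) (of_nat m))"
    using assms(2,4) far by (intro norm_poly_gt_if_far_from_roots) (auto simp: deg)
  also have "\<dots> = real_of_int \<bar>poly g (int m)\<bar>"
    using poly_of_int_poly[of g "int m", where 'a = complex] by simp
  finally have "real_of_int (int d) < real_of_int \<bar>poly g (int m)\<bar>" by simp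
  then show ?thesis by (simp only: of_int_less_iff)
qed

text \<open>Choose for each \<open>x\<close> a prime \<open>p x\<close> dividing both
  \<open>v x\<close> and \<open>q\<close>. The product of these primes, repetitions included,
  divides \<open>d * q\<close> and is coprime to \<open>d\<close>, so it divides
  \<open>q\<close>.\<close>

lemma size_le_num_prime_factors:
  fixes d q :: nat
  assumes dvd: "(\<Prod>x\<in>#M. v x) dvd d * q" and "coprime d q" and "q > 0"
    and "\<And>x. x \<in># M \<Longrightarrow> \<not> coprime (v x) q"
  shows "size M \<le> num_prime_factors q"
proof -
  have "\<exists>p. prime p \<and> p dvd v x \<and> p dvd q" if "x \<in># M" for x
    using assms(4)[OF that] by (metis coprime_iff_gcd_eq_1 gcd_nat.bounded_iff prime_factor_nat)
  then obtain p where p: "\<And>x. x \<in># M \<Longrightarrow> prime (p x) \<and> p x dvd v x \<and> p x dvd q"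
    by metis
  have "N \<subseteq># M \<Longrightarrow> (\<Prod>x\<in>#N. p x) dvd (\<Prod>x\<in>#N. v x) \<and> coprime (\<Prod>x\<in>#N. p x) d" for N
  proof (induction N)
    case (add x N)
    then have "x \<in># M" "N \<subseteq># M"
      by (auto dest: mset_subset_eq_insertD subset_mset.less_imp_le)
    moreover have "coprime (p x) d"
      using p[OF \<open>x \<in># M\<close>] \<open>coprime d q\<close> coprime_divisors[of "p x" q d d]
      by (auto simp: coprime_commute)
    ultimately show ?case using add.IH p[of x] by (auto intro: mult_dvd_mono)
  qed simp
  then have "(\<Prod>x\<in>#M. p x) dvd d * q" "coprime (\<Prod>x\<in>#M. p x) d"
    using dvd dvd_trans by blast+
  then have "(\<Prod>x\<in>#M. p x) dvd q" by (simp add: coprime_dvd_mult_right_iff)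
  moreover have "(\<Prod>x\<in>#M. p x) \<noteq> 0" 
  proof
    assume "(\<Prod>x\<in>#M. p x) = 0"
    then obtain x where "x \<in># M" "p x = 0" by auto
    with p[of x] show False by simp
  qed
  \<comment> \<open>Divisibility becomes inclusion of multisets, so a prime chosen several times is
    counted with its multiplicity in \<open>q\<close>.\<close>
  ultimately have "prime_factorization (\<Prod>x\<in>#M. p x) \<subseteq># prime_factorization q"
    using \<open>q > 0\<close> by (subst prime_factorization_subset_iff_dvd) auto
  moreover have "prime_factorization (\<Prod>x\<in>#M. p x) = image_mset p M"
    using p by (intro prime_factorization_prod_mset_primes) auto
  ultimately show ?thesis
    unfolding num_prime_factors_def by (metis size_mset_mono size_image_mset)
qed

text \<open>Prime factorization determines \<open>h\<close> only up to a unit. Since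
  \<open>h\<close> is not a unit, there is a prime factor that can absorb it.\<close>

lemma irreducible_factorization_exists:
  fixes h :: "'a :: factorial_semiring"
  assumes "h \<noteq> 0" and "\<not> is_unit h"
  obtains gs where "h = prod_mset gs" and "\<And>g. g \<in># gs \<Longrightarrow> irreducible g"
proof -
  obtain A where A: "\<And>x. x \<in># A \<Longrightarrow> prime x" "normalize (prod_mset A) = normalize h"
    using prime_factorization_exists' assms(1) by blast
  from A(2) obtain u where u: "is_unit u" "h = u * prod_mset A"
    by (metis associatedE2)
  with assms(2) have "A \<noteq> {#}" by auto
  then obtain x B where B: "A = add_mset x B" by (metis multiset_cases)
  have irr: "irreducible y" if "y \<in># A" for y
    using A(1)[OF that] prime_elem_imp_irreducible by auto
  show ?thesis
  proof (rule that[of "add_mset (u * x) B"])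
    show "h = prod_mset (add_mset (u * x) B)" by (simp add: u(2) B mult.assoc)
    show "irreducible g" if "g \<in># add_mset (u * x) B" for g
      using that irr u(1) by (auto simp: B irreducible_mult_unit_left)
  qed
qed

text \<open>Stated for a divisor \<open>h\<close> so that it serves both \<open>f\<close> and its
  primitive part. Evaluation at \<open>m\<close> is multiplicative, so the values of the irreducible
  factors of \<open>h\<close> multiply to a divisor of \<open>d * q\<close>, and the prime count
  applies.\<close>

lemma factors_bounded_by_value_primes:
  fixes f h :: "int poly" and m d q :: nat
  assumes "h dvd f" and "h \<noteq> 0" and "\<not> is_unit h"
    and val: "nat \<bar>poly f (int m)\<bar> = d * q" and "coprime d q" and "q > 0"
    and ncop: "\<And>g. g dvd h \<Longrightarrow> irreducible g \<Longrightarrow> \<not> coprime (nat \<bar>poly g (int m)\<bar>) q"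
  shows "product_of_at_most_irreducibles (num_prime_factors q) h \<and>
         (num_prime_factors q = 1 \<longrightarrow> irreducible h)"
proof -
  obtain gs where gs: "h = prod_mset gs" "\<And>g. g \<in># gs \<Longrightarrow> irreducible g"
    using irreducible_factorization_exists assms(2,3) by blast
  have "(\<Prod>g\<in>#gs. nat \<bar>poly g (int m)\<bar>) = nat \<bar>poly (prod_mset gs) (int m)\<bar>"
    by (induction gs) (auto simp: abs_mult nat_mult_distrib)
  also have "\<dots> dvd d * q"
    using assms(1) unfolding val[symmetric] gs(1)[symmetric]
    by (auto simp: nat_dvd_iff abs_mult nat_mult_distrib elim!: dvdE)
  finally have size: "size gs \<le> num_prime_factors q"
    proof (rule size_le_num_prime_factors[OF _ assms(5,6)])
    show "\<not> coprime (nat \<bar>poly g (int m)\<bar>) q" if "g \<in># gs" for g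
      using that gs by (intro ncop) (auto intro: dvd_prod_mset)
  qed
  moreover have "irreducible h" if "num_prime_factors q = 1"
  proof -
    \<comment> \<open>An empty factorization would give the unit 1, so the bound 1 leaves exactly
      one factor.\<close>
    have "gs \<noteq> {#}" using gs(1) assms(3) by auto
    with size that have "size gs = 1" by (metis le_antisym less_one not_less size_eq_0_iff_empty)
    then obtain g where "gs = {#g#}" using size_1_singleton_mset by blast
    with gs show ?thesis by simp
  qed
  ultimately show ?thesis
    using gs unfolding product_of_at_most_irreducibles_def by blast
qed

theorem theorem1:
  fixes f :: "int poly" and m d \<nu> :: nat
  assumes "degree f \<ge> 1"
    and "m > 0" and "d > 0"
    and "real m \<ge> coeff_height f + real d + 1"
    and "unitary_divisor d (nat \<bar>poly f (int m)\<bar>)"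
    and "nat \<bar>poly f (int m)\<bar> div d > 1"
    and "\<nu> = num_prime_factors (nat \<bar>poly f (int m)\<bar> div d)"
  shows "(coprime (content f) (int d) \<longrightarrow>
            product_of_at_most_irreducibles \<nu> f \<and> (\<nu> = 1 \<longrightarrow> irreducible f)) \<and>
         product_of_at_most_irreducibles \<nu> (primitive_part f) \<and>
         (\<nu> = 1 \<longrightarrow> irreducible (primitive_part f))"
proof -
  define q where "q = nat \<bar>poly f (int m)\<bar> div d"
  have val: "nat \<bar>poly f (int m)\<bar> = d * q" and cop: "coprime d q" and "q > 0"
    using assms(5,6) by (auto simp: unitary_divisor_def q_def coprime_iff_gcd_eq_1)
  have \<nu>: "\<nu> = num_prime_factors q" using assms(7) by (simp add: q_def)
  have "f \<noteq> 0" using assms(1) by auto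
  have dvd_val: "nat \<bar>poly g (int m)\<bar> dvd d * q" if "g dvd f" for g
    using that unfolding val[symmetric]
    by (auto simp: nat_mult_distrib abs_mult elim!: dvdE)
  \<comment> \<open>A value coprime to \<open>q\<close> would have to divide \<open>d\<close>, but
    it exceeds \<open>d\<close>.\<close>
  have nonconst: "\<not> coprime (nat \<bar>poly g (int m)\<bar>) q" if "g dvd f" "degree g > 0" for g
  proof
    assume "coprime (nat \<bar>poly g (int m)\<bar>) q"
    then have "nat \<bar>poly g (int m)\<bar> dvd d"
      using dvd_val[OF that(1)] by (simp add: coprime_dvd_mult_left_iff)
    then have "nat \<bar>poly g (int m)\<bar> \<le> d" using \<open>d > 0\<close> by (rule dvd_imp_le)
    moreover have "\<bar>poly g (int m)\<bar> > int d"
      using nonconst_dvd_value_gt that \<open>f \<noteq> 0\<close> assms(3,4) by blast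
    ultimately show False by linarith
  qed
  \<comment> \<open>Size says nothing about a constant factor \<open>c\<close>. It divides the
    content, hence is coprime to \<open>d\<close>; were it also coprime to \<open>q\<close>, it
    would be coprime to its own multiple \<open>d * q\<close> and thus a unit.\<close>
  have const: "\<not> coprime (nat \<bar>poly g (int m)\<bar>) q"
    if g: "g dvd f" "irreducible g" "degree g = 0" and cont: "coprime (content f) (int d)" for g
  proof
    obtain c where c: "g = [:c:]" using g(3) by (auto elim: degree_eq_zeroE)
    have "c dvd content f" using g(1) by (simp add: c const_poly_dvd_iff_dvd_content)
    then have "coprime c (int d)" using cont by (rule coprime_divisors[OF _ dvd_refl])
    then have "coprime (nat \<bar>c\<bar>) d" by (simp flip: coprime_int_iff)
    moreover assume "coprime (nat \<bar>poly g (int m)\<bar>) q"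
    ultimately have "coprime (nat \<bar>c\<bar>) (d * q)" by (simp add: c)
    moreover have "nat \<bar>c\<bar> dvd d * q" using dvd_val[OF g(1)] by (simp add: c)
    ultimately have "nat \<bar>c\<bar> dvd 1" using coprime_common_divisor dvd_refl by blast
    then have "is_unit c" by (simp add: nat_eq_iff)
    then have "is_unit g" by (simp add: c is_unit_const_poly_iff)
    with g(2) show False by (simp add: irreducible_def)
  qed
  have "\<not> is_unit f" using assms(1) by (auto simp: is_unit_poly_iff)
  then have "product_of_at_most_irreducibles \<nu> f \<and> (\<nu> = 1 \<longrightarrow> irreducible f)"
    if "coprime (content f) (int d)"
    unfolding \<nu> using that nonconst const \<open>f \<noteq> 0\<close> val cop \<open>q > 0\<close>
    by (intro factors_bounded_by_value_primes) auto
  moreover have "product_of_at_most_irreducibles \<nu> (primitive_part f) \<and>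
      (\<nu> = 1 \<longrightarrow> irreducible (primitive_part f))"
    unfolding \<nu>
  proof (rule factors_bounded_by_value_primes[OF _ _ _ val cop \<open>q > 0\<close>])
    show pf: "primitive_part f dvd f"
      by (metis content_times_primitive_part dvd_smult dvd_refl)
    show "primitive_part f \<noteq> 0" using \<open>f \<noteq> 0\<close> by simp
    show "\<not> is_unit (primitive_part f)"
      using assms(1) by (auto simp: is_unit_poly_iff dest!: arg_cong[of _ _ degree])
    show "\<not> coprime (nat \<bar>poly g (int m)\<bar>) q" if g: "g dvd primitive_part f" "irreducible g" for g
    proof (rule nonconst)
      show "g dvd f" using g(1) pf by (rule dvd_trans)
      \<comment> \<open>A constant divisor of the primitive part divides its content, which is 1,
        and so is a unit. Every irreducible factor is therefore nonconstant and covered by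
        \<open>nonconst\<close>.\<close>
      show "degree g > 0"
      proof (rule ccontr)
        assume "\<not> degree g > 0"
        then obtain c where c: "g = [:c:]" by (auto elim: degree_eq_zeroE)
        have "c dvd content (primitive_part f)"
          using g(1) by (simp add: c const_poly_dvd_iff_dvd_content)
        then have "is_unit g" using \<open>f \<noteq> 0\<close> by (simp add: c is_unit_const_poly_iff)
        with g(2) show False by (simp add: irreducible_def)
      qed
    qed
  qed
  ultimately show ?thesis by blast
qed

end
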